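(* Let $\mathfrak U$ and $\mathfrak V$ be generalized models (in the narrow sense) in the same signature with universes $\beta X$ and $\beta Y$, both with interpretations pseudo-principal on functional symbols. Let $\mathfrak A$ and $\mathfrak B$ be ordinary models with universes $X$ and $Y$ such that $\widetilde{\mathfrak A}=e(\mathfrak U)$ and $\widetilde{\mathfrak B}=e(\mathfrak V)$ (so that $\mathfrak A^*=E(\mathfrak U)$ and $\mathfrak B^*=E(\mathfrak V)$), and let $h:X\to Y$. The following are equivalent: (i) $h$ is a homomorphism of $\mathfrak A$ into $\mathfrak B$; (ii) $\tilde h$ is a homomorphism of $\mathfrak U$ into $\mathfrak V$; (iii) $\tilde h$ is a homomorphism of $\widetilde{\mathfrak A}$ into $\widetilde{\mathfrak B}$; (iv) $\tilde h$ is a homomorphism of $\mathfrak A^*$ into $\mathfrak B^*$.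
   Context: $\beta Z$ is the set of ultrafilters on $Z$, $Z\subseteq\beta Z$ via principal ultrafilters, standard compact Hausdorff topology; $(\forall^{\mathfrak u}z)\varphi$ means $\{z:\varphi\}\in\mathfrak u$. For $h:X\to Y$, $\tilde h:\beta X\to\beta Y$ is $\tilde h(\mathfrak u)=\{A\subseteq Y:h^{-1}(A)\in\mathfrak u\}$ (the continuous extension). For $f:Z^n\to Z$, $\tilde f(\mathfrak u_1,\dots,\mathfrak u_n)=\{A:(\forall^{\mathfrak u_1}z_1)\cdots(\forall^{\mathfrak u_n}z_n)f(z_1,\dots,z_n)\in A\}$; for $Q\subseteq Z^n$, $\tilde Q=\{(\mathfrak u_i):(\forall^{\mathfrak u_1}z_1)\cdots(\forall^{\mathfrak u_n}z_n)(z_1,\dots,z_n)\in Q\}$ and $Q^*=\{(\mathfrak u_i):\forall A_i\in\mathfrak u_i\ Q\cap(A_1\times\dots\times A_n)\ne\emptyset\}$; for an ordinary model $\mathfrak A=(Z,F,\dots,R,\dots)$, $\widetilde{\mathfrak A}=(\beta Z,\tilde F,\dots,\tilde R,\dots)$ and $\mathfrak A^*=(\beta Z,\tilde F,\dots,R^*,\dots)$. A homomorphism of ordinary models is a map commuting with all operations and sending tuples in each relation to tuples in the corresponding relation. A generalized model in the narrow sense with universe $\beta Z$ is an interpretation $\imath$ with $\imath(F)\in\beta(Z^{Z^n})$, $\imath(R)\in\beta\,\mathcal P(Z^n)$ for $n$-ary symbols; it is pseudo-principal on functional symbols if for every $F$ and all $a_1,\dots,a_n\in Z$, $\{A:(\forall^{\imath(F)}f)f(a_1,\dots,a_n)\in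 A\}$ is principal. $e,E$: $e=E$ on $\beta(Z^{Z^n})$ is the unique continuous extension of $f\mapsto\tilde f$ into the compact Hausdorff space of $n$-ary operations on $\beta Z$ right continuous w.r.t. $Z$ (continuous in the $i$-th argument when the first $i-1$ arguments are in $Z$), topologized by pointwise convergence on $Z^n$; $e$ on $\beta\,\mathcal P(Z^n)$ is the same construction via characteristic functions into discrete $\{0,1\}$; $E(\mathfrak r)=\{(\pi_1(\mathfrak q),\dots,\pi_n(\mathfrak q)):\mathfrak q\in e_1(\mathfrak r)\}$ with $e_1(\mathfrak r)\subseteq\beta(Z^n)$ the $e$-construction applied to $\mathfrak r$ as an ultrafilter over unary relations on $Z^n$, $\pi_i(\mathfrak q)=\{A:\{x:x_i\in A\}\in\mathfrak q\}$. $e(\mathfrak U)$, $E(\mathfrak U)$ are the ordinary models on $\beta Z$ obtained by applying $e$, resp. $E$, to each interpreting ultrafilter. A map $g:\beta X\to\beta Y$ is a homomorphism of generalized models $\mathfrak U$ into $\mathfrak V$ iff it is a homomorphism of $e(\mathfrak U)$ into $e(\mathfrak V)$. *)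

theory Defs
  imports "HOL-Analysis.Analysis"
begin

text \<open>
  An ultrafilter on a set \<open>S\<close> is represented by a value of the library type of filters on the
  ambient type that contains \<open>S\<close>; thus \<open>A \<in> u\<close> reads
  \<open>\<forall>\<^sub>F x in u. x \<in> A\<close>, the ultrafilter quantifier is \<open>\<forall>\<^sub>F\<close>, the principal ultrafilter
  of \<open>x\<close> is \<open>principal {x}\<close>, and the continuous extension of \<open>h : X \<rightarrow> Y\<close> to ultrafilters is
  \<open>filtermap h\<close>.
\<close>

section \<open>Spaces of ultrafilters\<close>

definition beta :: "'a set \<Rightarrow> 'a filter set" where
  "beta S = {u. u \<noteq> bot \<and> eventually (\<lambda>x. x \<in> S) u \<and>
                (\<forall>P. eventually P u \<or> eventually (\<lambda>x. \<not> P x) u)}"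

definition beta_topology :: "'a set \<Rightarrow> 'a filter topology" where
  "beta_topology S =
     topology_generated_by {{u \<in> beta S. \<forall>\<^sub>F x in u. x \<in> A} | A. A \<subseteq> S}"

text \<open>The set \<open>Z\<^sup>n\<close>, as lists of length \<open>n\<close>.\<close>

definition tuples :: "'a set \<Rightarrow> nat \<Rightarrow> 'a list set" where
  "tuples Z n = {xs. length xs = n \<and> set xs \<subseteq> Z}"

abbreviation princ :: "'a \<Rightarrow> 'a filter" where
  "princ x \<equiv> principal {x}"

section \<open>Ultrafilter extensions of operations and relations\<close>

text \<open>\<open>uf_all [u\<^sub>1, \<dots>, u\<^sub>n] P\<close> is the iterated quantifier
  \<open>\<forall>\<^sub>F z\<^sub>1 in u\<^sub>1. \<dots> \<forall>\<^sub>F z\<^sub>n in u\<^sub>n. P [z\<^sub>1, \<dots>, z\<^sub>n]\<close>.\<close>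

primrec uf_all :: "'a filter list \<Rightarrow> ('a list \<Rightarrow> bool) \<Rightarrow> bool" where
  "uf_all [] P = P []"
| "uf_all (u # us) P = (\<forall>\<^sub>F z in u. uf_all us (\<lambda>zs. P (z # zs)))"

lemma is_filter_uf_all: "is_filter (\<lambda>P. uf_all us (\<lambda>zs. P (f zs)))"
proof (induction us arbitrary: f)
  case Nil
  show ?case by (simp add: is_filter_def)
next
  case (Cons u us)
  note IH = Cons.IH[of "\<lambda>zs. f (z # zs)" for z]
  show ?case
  proof
    show "uf_all (u # us) (\<lambda>zs. True)"
      using is_filter.True[OF IH] by simp
  next
    fix P Q
    assume "uf_all (u # us) (\<lambda>zs. P (f zs))" "uf_all (u # us) (\<lambda>zs. Q (f zs))"
    then have "\<forall>\<^sub>F z in u. uf_all us (\<lambda>zs. P (f (z # zs))) \<and> uf_all us (\<lambda>zs. Q (f (z # zs)))"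
      by (simp add: eventually_conj)
    then show "uf_all (u # us) (\<lambda>zs. P (f zs) \<and> Q (f zs))"
      unfolding uf_all.simps by (rule eventually_mono) (metis is_filter.conj[OF IH])
  next
    fix P Q
    assume *: "\<forall>x. P x \<longrightarrow> Q x" and "uf_all (u # us) (\<lambda>zs. P (f zs))"
    then have "\<forall>\<^sub>F z in u. uf_all us (\<lambda>zs. P (f (z # zs)))"
      by simp
    then show "uf_all (u # us) (\<lambda>zs. Q (f zs))"
      unfolding uf_all.simps by (rule eventually_mono) (rule is_filter.mono[OF IH *])
  qed
qed

definition tilde_fun :: "'a set \<Rightarrow> nat \<Rightarrow> ('a list \<Rightarrow> 'a) \<Rightarrow> 'a filter list \<Rightarrow> 'a filter" where
  "tilde_fun Z n f = (\<lambda>us\<in>tuples (beta Z) n. Abs_filter (\<lambda>P. uf_all us (\<lambda>zs. P (f zs))))"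

lemma eventually_tilde_fun:
  assumes "us \<in> tuples (beta Z) n"
  shows "eventually P (tilde_fun Z n f us) \<longleftrightarrow> uf_all us (\<lambda>zs. P (f zs))"
  using assms by (simp add: tilde_fun_def eventually_Abs_filter is_filter_uf_all)

definition tilde_rel :: "'a set \<Rightarrow> nat \<Rightarrow> 'a list set \<Rightarrow> 'a filter list set" where
  "tilde_rel Z n Q = {us \<in> tuples (beta Z) n. uf_all us (\<lambda>zs. zs \<in> Q)}"

text \<open>\<open>listset [A\<^sub>1, \<dots>, A\<^sub>n]\<close> is the product \<open>A\<^sub>1 \<times> \<dots> \<times> A\<^sub>n\<close>.\<close>

definition star_rel :: "'a set \<Rightarrow> nat \<Rightarrow> 'a list set \<Rightarrow> 'a filter list set" where
  "star_rel Z n Q = {us \<in> tuples (beta Z) n.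
     \<forall>As. list_all2 (\<lambda>A u. \<forall>\<^sub>F z in u. z \<in> A) As us \<longrightarrow> Q \<inter> listset As \<noteq> {}}"

section \<open>Signatures and ordinary models\<close>

record ('f, 'r) signature =
  fun_syms :: "'f set"
  rel_syms :: "'r set"
  fun_ar :: "'f \<Rightarrow> nat"
  rel_ar :: "'r \<Rightarrow> nat"

record ('u, 'f, 'r) model =
  universe :: "'u set"
  fun_int :: "'f \<Rightarrow> 'u list \<Rightarrow> 'u"
  rel_int :: "'r \<Rightarrow> 'u list set"

text \<open>Interpretations are extensional, so that two models are equal as records iff they agree on
  the universe and on all symbols of the signature.\<close>

definition is_model :: "('f, 'r) signature \<Rightarrow> ('u, 'f, 'r) model \<Rightarrow> bool" where
  "is_model \<sigma> M \<longleftrightarrow> universe M \<noteq> {} \<and>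
     fun_int M \<in> (\<Pi>\<^sub>E F\<in>fun_syms \<sigma>. tuples (universe M) (fun_ar \<sigma> F) \<rightarrow>\<^sub>E universe M) \<and>
     rel_int M \<in> (\<Pi>\<^sub>E R\<in>rel_syms \<sigma>. Pow (tuples (universe M) (rel_ar \<sigma> R)))"

definition homomorphism ::
    "('f, 'r) signature \<Rightarrow> ('u, 'f, 'r) model \<Rightarrow> ('v, 'f, 'r) model \<Rightarrow> ('u \<Rightarrow> 'v) \<Rightarrow> bool" where
  "homomorphism \<sigma> M N g \<longleftrightarrow> g \<in> universe M \<rightarrow> universe N \<and>
     (\<forall>F\<in>fun_syms \<sigma>. \<forall>xs\<in>tuples (universe M) (fun_ar \<sigma> F).
        g (fun_int M F xs) = fun_int N F (map g xs)) \<and>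
     (\<forall>R\<in>rel_syms \<sigma>. \<forall>xs\<in>rel_int M R. map g xs \<in> rel_int N R)"

definition tilde_model ::
    "('f, 'r) signature \<Rightarrow> ('a, 'f, 'r) model \<Rightarrow> ('a filter, 'f, 'r) model" where
  "tilde_model \<sigma> M =
     \<lparr>universe = beta (universe M),
      fun_int = (\<lambda>F\<in>fun_syms \<sigma>. tilde_fun (universe M) (fun_ar \<sigma> F) (fun_int M F)),
      rel_int = (\<lambda>R\<in>rel_syms \<sigma>. tilde_rel (universe M) (rel_ar \<sigma> R) (rel_int M R))\<rparr>"

definition star_model ::
    "('f, 'r) signature \<Rightarrow> ('a, 'f, 'r) model \<Rightarrow> ('a filter, 'f, 'r) model" where
  "star_model \<sigma> M =
     \<lparr>universe = beta (universe M),
      fun_int = (\<lambda>F\<in>fun_syms \<sigma>. tilde_fun (universe M) (fun_ar \<sigma> F) (fun_int M F)),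
      rel_int = (\<lambda>R\<in>rel_syms \<sigma>. star_rel (universe M) (rel_ar \<sigma> R) (rel_int M R))\<rparr>"

section \<open>Right continuous maps and the operations \<open>e\<close> and \<open>E\<close>\<close>

text \<open>The maps \<open>(\<beta>Z)\<^sup>n \<rightarrow> K\<close> that are right continuous w.r.t. \<open>Z\<close>: continuous in each argument
  whenever all arguments to the left of it are principal.\<close>

definition rc_maps :: "'a set \<Rightarrow> nat \<Rightarrow> 'k topology \<Rightarrow> ('a filter list \<Rightarrow> 'k) set" where
  "rc_maps Z n K = {G \<in> tuples (beta Z) n \<rightarrow>\<^sub>E topspace K.
     \<forall>i<n. \<forall>as\<in>tuples Z i. \<forall>vs\<in>tuples (beta Z) (n - Suc i).
       continuous_map (beta_topology Z) K (\<lambda>u. G (map princ as @ u # vs))}"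

text \<open>Right continuous maps with the topology of pointwise convergence on \<open>Z\<^sup>n\<close>.\<close>

definition rc_topology :: "'a set \<Rightarrow> nat \<Rightarrow> 'k topology \<Rightarrow> ('a filter list \<Rightarrow> 'k) topology" where
  "rc_topology Z n K =
     pullback_topology (rc_maps Z n K) (\<lambda>G. \<lambda>as\<in>tuples Z n. G (map princ as))
       (product_topology (\<lambda>_. K) (tuples Z n))"

text \<open>The unique continuous extension of \<open>\<phi> : S \<rightarrow> T\<close> to \<open>\<beta>S\<close>.\<close>

definition beta_ext :: "'s set \<Rightarrow> 't topology \<Rightarrow> ('s \<Rightarrow> 't) \<Rightarrow> 's filter \<Rightarrow> 't" where
  "beta_ext S T \<phi> = (THE g. g \<in> extensional (beta S) \<and>
     continuous_map (beta_topology S) T g \<and> (\<forall>x\<in>S. g (princ x) = \<phi> x))"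

definition e_fun ::
    "'a set \<Rightarrow> nat \<Rightarrow> ('a list \<Rightarrow> 'a) filter \<Rightarrow> 'a filter list \<Rightarrow> 'a filter" where
  "e_fun Z n = beta_ext (tuples Z n \<rightarrow>\<^sub>E Z) (rc_topology Z n (beta_topology Z)) (tilde_fun Z n)"

text \<open>For relations, the discrete space \<open>{0,1}\<close> of values of characteristic functions is the
  discrete space of truth values.\<close>

definition e_rel :: "'a set \<Rightarrow> nat \<Rightarrow> 'a list set filter \<Rightarrow> 'a filter list set" where
  "e_rel Z n r = {us \<in> tuples (beta Z) n.
     beta_ext (Pow (tuples Z n)) (rc_topology Z n (discrete_topology (UNIV :: bool set)))
       (\<lambda>Q. \<lambda>us\<in>tuples (beta Z) n. us \<in> tilde_rel Z n Q) r us}"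

text \<open>\<open>e\<^sub>1\<close> regards \<open>r\<close> as an ultrafilter over unary relations on the set \<open>Z\<^sup>n\<close>; these are sets of
  lists of length one, hence the renaming of \<open>x\<close> to \<open>[x]\<close>.\<close>

definition e1_rel :: "'a set \<Rightarrow> nat \<Rightarrow> 'a list set filter \<Rightarrow> 'a list filter set" where
  "e1_rel Z n r =
     {q. [q] \<in> e_rel (tuples Z n) 1 (filtermap (\<lambda>Q. (\<lambda>x. [x]) ` Q) r)}"

definition E_rel :: "'a set \<Rightarrow> nat \<Rightarrow> 'a list set filter \<Rightarrow> 'a filter list set" where
  "E_rel Z n r = {map (\<lambda>i. filtermap (\<lambda>xs. xs ! i) q) [0..<n] | q. q \<in> e1_rel Z n r}"

section \<open>Generalized models in the narrow sense\<close>

text \<open>\<open>gbase U\<close> is the set \<open>Z\<close>; the universe of the generalized model is \<open>beta Z\<close>.\<close>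

record ('a, 'f, 'r) gmodel =
  gbase :: "'a set"
  gfun_int :: "'f \<Rightarrow> ('a list \<Rightarrow> 'a) filter"
  grel_int :: "'r \<Rightarrow> 'a list set filter"

definition is_gmodel :: "('f, 'r) signature \<Rightarrow> ('a, 'f, 'r) gmodel \<Rightarrow> bool" where
  "is_gmodel \<sigma> U \<longleftrightarrow> gbase U \<noteq> {} \<and>
     (\<forall>F\<in>fun_syms \<sigma>. gfun_int U F \<in> beta (tuples (gbase U) (fun_ar \<sigma> F) \<rightarrow>\<^sub>E gbase U)) \<and>
     (\<forall>R\<in>rel_syms \<sigma>. grel_int U R \<in> beta (Pow (tuples (gbase U) (rel_ar \<sigma> R))))"

definition pseudo_principal_on_funs :: "('f, 'r) signature \<Rightarrow> ('a, 'f, 'r) gmodel \<Rightarrow> bool" where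
  "pseudo_principal_on_funs \<sigma> U \<longleftrightarrow>
     (\<forall>F\<in>fun_syms \<sigma>. \<forall>as\<in>tuples (gbase U) (fun_ar \<sigma> F).
        \<exists>z\<in>gbase U. filtermap (\<lambda>f. f as) (gfun_int U F) = princ z)"

definition e_model ::
    "('f, 'r) signature \<Rightarrow> ('a, 'f, 'r) gmodel \<Rightarrow> ('a filter, 'f, 'r) model" where
  "e_model \<sigma> U =
     \<lparr>universe = beta (gbase U),
      fun_int = (\<lambda>F\<in>fun_syms \<sigma>. e_fun (gbase U) (fun_ar \<sigma> F) (gfun_int U F)),
      rel_int = (\<lambda>R\<in>rel_syms \<sigma>. e_rel (gbase U) (rel_ar \<sigma> R) (grel_int U R))\<rparr>"

text \<open>On functional symbols, \<open>E\<close> coincides with \<open>e\<close> by definition.\<close>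

definition E_model ::
    "('f, 'r) signature \<Rightarrow> ('a, 'f, 'r) gmodel \<Rightarrow> ('a filter, 'f, 'r) model" where
  "E_model \<sigma> U =
     \<lparr>universe = beta (gbase U),
      fun_int = (\<lambda>F\<in>fun_syms \<sigma>. e_fun (gbase U) (fun_ar \<sigma> F) (gfun_int U F)),
      rel_int = (\<lambda>R\<in>rel_syms \<sigma>. E_rel (gbase U) (rel_ar \<sigma> R) (grel_int U R))\<rparr>"

definition gen_homomorphism ::
    "('f, 'r) signature \<Rightarrow> ('a, 'f, 'r) gmodel \<Rightarrow> ('b, 'f, 'r) gmodel \<Rightarrow>
     ('a filter \<Rightarrow> 'b filter) \<Rightarrow> bool" where
  "gen_homomorphism \<sigma> U V g \<longleftrightarrow> homomorphism \<sigma> (e_model \<sigma> U) (e_model \<sigma> V) g"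

end

theory Submission
  imports Defs
begin

text \<open>
  A right continuous map is determined by its values at principal tuples, so the continuous
  extension \<open>e\<close> sends an ultrafilter \<open>r\<close> of relations to the extension \<open>tilde_rel Z n Q\<close> of a single
  ordinary relation, \<open>Q = {as. \<forall>\<^sub>F R in r. as \<in> R}\<close>. As \<open>Q\<close> can be read off at
  principal tuples, it is the relation of the given ordinary model. Dually \<open>E r\<close> consists of the
  projections of the ultrafilters on \<open>Z\<^sup>n\<close> containing \<open>Q\<close>; by the ultrafilter lemma these are the
  tuples in \<open>star_rel Z n Q\<close>. Homomorphisms lift because both extensions are monotone under
  \<open>filtermap h\<close>, and they descend because the extensions are conservative at principal tuples.
\<close>

section \<open>Ultrafilters\<close>

lemma beta_not_bot: "u \<in> beta S \<Longrightarrow> u \<noteq> bot"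
  by (simp add: beta_def)

lemma beta_eventually: "u \<in> beta S \<Longrightarrow> \<forall>\<^sub>F x in u. x \<in> S"
  by (simp add: beta_def)

lemma beta_eventually_not:
  assumes "u \<in> beta S"
  shows "(\<forall>\<^sub>F x in u. \<not> P x) \<longleftrightarrow> \<not> (\<forall>\<^sub>F x in u. P x)"
proof -
  have "\<not> ((\<forall>\<^sub>F x in u. P x) \<and> (\<forall>\<^sub>F x in u. \<not> P x))"
    using beta_not_bot[OF assms] by (simp flip: eventually_conj_iff)
  then show ?thesis
    using assms unfolding beta_def by blast
qed

lemma princ_in_beta: "x \<in> S \<Longrightarrow> princ x \<in> beta S"
  by (simp add: beta_def eventually_principal principal_eq_bot_iff)

lemma map_princ_in_tuples: "as \<in> tuples S n \<Longrightarrow> map princ as \<in> tuples (beta S) n"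
  by (auto simp: tuples_def intro: princ_in_beta)

lemma map_in_tuples:
  assumes "g \<in> S \<rightarrow> T" "as \<in> tuples S n"
  shows "map g as \<in> tuples T n"
  using assms by (auto simp: tuples_def)

lemma filtermap_in_beta:
  assumes "k \<in> S \<rightarrow> T" "u \<in> beta S"
  shows "filtermap k u \<in> beta T"
proof -
  have "\<forall>\<^sub>F x in u. k x \<in> T"
    using beta_eventually[OF assms(2)] assms(1) by (auto elim!: eventually_mono)
  then show ?thesis
    using assms(2) by (simp add: beta_def filtermap_bot_iff eventually_filtermap)
qed

lemma map_filtermap_in_tuples:
  assumes "h \<in> X \<rightarrow> Y" "us \<in> tuples (beta X) n"
  shows "map (filtermap h) us \<in> tuples (beta Y) n"
  using filtermap_in_beta[OF assms(1)] by (intro map_in_tuples[OF _ assms(2)] Pi_I)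

lemma filtermap_map_princ: "map (filtermap h) (map princ as) = map princ (map h as)"
  by simp

text \<open>In the library order a smaller filter has more eventual properties, so ultrafilters are
  the minimal proper filters. If \<open>P\<close> held in \<open>v\<close> but not in
  \<open>u\<close>, the negation of \<open>P\<close> would hold in \<open>u\<close>, hence in
  \<open>v\<close>, and \<open>v\<close> would be improper.\<close>

lemma beta_le_imp_eq:
  assumes "u \<in> beta S" "v \<noteq> bot" "v \<le> u"
  shows "v = u"
proof (rule filter_eq_iff[THEN iffD2], intro allI iffI)
  fix P
  assume P: "eventually P v"
  show "eventually P u"
  proof (rule ccontr)
    assume "\<not> eventually P u"
    then have "eventually (\<lambda>x. \<not> P x) v"
      using assms(1,3) beta_eventually_not by (blast intro: filter_leD)
    with P have "eventually (\<lambda>x. False) v"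
      by eventually_elim simp
    then show False
      using assms(2) by (simp add: trivial_limit_def)
  qed
qed (use assms(3) in \<open>auto intro: filter_leD\<close>)

text \<open>The ultrafilter lemma, by Zorn: a minimal proper filter below \<open>F\<close> decides
  every property.\<close>

lemma exists_ultrafilter_le:
  fixes F :: "'a filter"
  assumes "F \<noteq> bot"
  shows "\<exists>u \<in> beta UNIV. u \<le> F"
proof -
  define A where "A = {G. G \<noteq> bot \<and> G \<le> F}"
  \<comment> \<open>Zorn is applied to the reversed order, so that a maximal element is a minimal
    filter.\<close>
  have "\<exists>m\<in>A. \<forall>a\<in>A. m \<ge> a \<longrightarrow> a = m"
  proof (rule predicate_Zorn)
    show "partial_order_on A (relation_of (\<ge>) A)"
      by (rule partial_order_on_relation_ofI) auto
  next
    fix C assume C: "C \<in> Chains (relation_of (\<ge>) A)"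
    show "\<exists>u\<in>A. \<forall>a\<in>C. a \<ge> u"
    proof (cases "C = {}")
      case True
      then show ?thesis using assms by (auto simp: A_def)
    next
      case False
      have CA: "C \<subseteq> A" and tot: "\<And>G H. G \<in> C \<Longrightarrow> H \<in> C \<Longrightarrow> G \<le> H \<or> H \<le> G"
        using C by (auto simp: Chains_def relation_of_def)
      \<comment> \<open>A chain is directed downwards, so its infimum has exactly the properties
        that some member has. Falsity is not among them, which makes the infimum proper.\<close>
      have "eventually P (Inf C) \<longleftrightarrow> (\<exists>b\<in>C. eventually P b)" for P
        using False by (rule eventually_Inf_base) (metis inf.absorb1 inf.absorb2 order_refl tot)
      then have "Inf C \<noteq> bot"
        using CA by (auto simp: A_def trivial_limit_def)
      moreover have "Inf C \<le> F"
        using False CA by (auto simp: A_def intro: Inf_lower2)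
      ultimately show ?thesis
        by (auto simp: A_def intro!: bexI[of _ "Inf C"] Inf_lower)
    qed
  qed
  then obtain m where m: "m \<noteq> bot" "m \<le> F"
    and max: "\<And>G. G \<noteq> bot \<Longrightarrow> G \<le> m \<Longrightarrow> G = m"
    by (auto simp: A_def intro: order_trans)
  have "eventually P m" if "\<not> eventually (\<lambda>x. \<not> P x) m" for P
  proof -
    \<comment> \<open>Since the negation of \<open>P\<close> does not hold in \<open>m\<close>,
      restricting \<open>m\<close> to the set where \<open>P\<close> holds leaves a proper filter.
      By minimality this restriction is \<open>m\<close> itself.\<close>
    have "inf m (principal {x. P x}) \<noteq> bot"
      using that by (simp add: trivial_limit_def eventually_inf_principal)
    then have "inf m (principal {x. P x}) = m"
      by (intro max) auto
    moreover have "eventually P (inf m (principal {x. P x}))"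
      by (simp add: eventually_inf_principal)
    ultimately show ?thesis by simp
  qed
  then have "m \<in> beta UNIV"
    using m(1) unfolding beta_def by auto
  then show ?thesis
    using m(2) by blast
qed

section \<open>The topology on ultrafilters and right continuous maps\<close>

lemma topspace_beta_topology [simp]: "topspace (beta_topology S) = beta S"
  unfolding beta_topology_def topology_generated_by_topspace
  by (auto dest: beta_eventually)

lemma openin_beta_topology_basic:
  "openin (beta_topology S) {u \<in> beta S. eventually P u}"
proof -
  have "{u \<in> beta S. eventually P u} = {u \<in> beta S. \<forall>\<^sub>F x in u. x \<in> {x \<in> S. P x}}"
    by (auto simp: eventually_conj_iff dest: beta_eventually)
  then show ?thesis
    unfolding beta_topology_def
    by (intro topology_generated_by_Basis CollectI exI[of _ "{x \<in> S. P x}"]) auto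
qed

text \<open>Principal ultrafilters are dense: an open set around \<open>u\<close> contains all
  ultrafilters on \<open>S\<close> that contain a certain member \<open>A\<close> of
  \<open>u\<close>, and \<open>A\<close> meets \<open>S\<close>.\<close>

lemma beta_topology_dense:
  assumes "openin (beta_topology S) W" "u \<in> W"
  shows "\<exists>x\<in>S. princ x \<in> W"
proof -
  have "\<exists>A. (\<forall>\<^sub>F x in u. x \<in> A) \<and> (\<forall>v\<in>beta S. (\<forall>\<^sub>F x in v. x \<in> A) \<longrightarrow> v \<in> W)"
    if "generate_topology_on {{u \<in> beta S. \<forall>\<^sub>F x in u. x \<in> A} | A. A \<subseteq> S} W" "u \<in> W" for W
    using that
  proof (induction rule: generate_topology_on.induct)
    case (Int a b)
    from Int.prems have "u \<in> a" "u \<in> b" by simp_all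
    from Int.IH(1)[OF this(1)] Int.IH(2)[OF this(2)]
    obtain A B where "\<forall>\<^sub>F x in u. x \<in> A" "\<forall>v\<in>beta S. (\<forall>\<^sub>F x in v. x \<in> A) \<longrightarrow> v \<in> a"
      "\<forall>\<^sub>F x in u. x \<in> B" "\<forall>v\<in>beta S. (\<forall>\<^sub>F x in v. x \<in> B) \<longrightarrow> v \<in> b"
      by blast
    then show ?case
      by (intro exI[of _ "A \<inter> B"]) (simp add: eventually_conj_iff)
  next
    case (UN K)
    then show ?case by blast
  qed auto
  then obtain A where A: "\<forall>\<^sub>F x in u. x \<in> A"
      "\<And>v. v \<in> beta S \<Longrightarrow> \<forall>\<^sub>F x in v. x \<in> A \<Longrightarrow> v \<in> W"
    using assms unfolding beta_topology_def openin_topology_generated_by_iff by blast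
  have u: "u \<in> beta S"
    using assms openin_subset[of "beta_topology S" W] by auto
  have "\<exists>x. x \<in> A \<and> x \<in> S"
    using eventually_happens'[OF beta_not_bot[OF u] eventually_conj[OF A(1) beta_eventually[OF u]]] .
  then show ?thesis
    using A(2)[OF princ_in_beta] by (auto simp: eventually_principal)
qed

text \<open>If the values at \<open>u\<close> differed, disjoint open sets around them would pull
  back to an open neighbourhood of \<open>u\<close>. By density it contains a principal ultrafilter,
  where both maps agree.\<close>

lemma continuous_beta_unique:
  assumes f: "continuous_map (beta_topology S) K f" and g: "continuous_map (beta_topology S) K g"
    and K: "Hausdorff_space K"
    and eq: "\<And>x. x \<in> S \<Longrightarrow> f (princ x) = g (princ x)"
    and u: "u \<in> beta S"
  shows "f u = g u"
proof (rule ccontr)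
  assume ne: "f u \<noteq> g u"
  have "f u \<in> topspace K" "g u \<in> topspace K"
    using f g u by (auto dest!: continuous_map_funspace)
  then obtain C D where CD: "openin K C" "openin K D" "f u \<in> C" "g u \<in> D" "disjnt C D"
    using K ne unfolding Hausdorff_space_def by metis
  define W where "W = {v \<in> beta S. f v \<in> C} \<inter> {v \<in> beta S. g v \<in> D}"
  have "openin (beta_topology S) W"
    unfolding W_def using f g CD
    by (intro openin_Int) (auto dest: openin_continuous_map_preimage)
  moreover have "u \<in> W"
    using u CD by (simp add: W_def)
  ultimately obtain x where "x \<in> S" "princ x \<in> W"
    using beta_topology_dense by blast
  then show False
    using CD(5) eq[of x] by (auto simp: W_def disjnt_iff)
qed

text \<open>The set of ultrafilters on \<open>S\<close> in which \<open>P\<close> holds is clopen,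
  because its complement is the basic open set given by the negation of \<open>P\<close>.\<close>

lemma continuous_map_beta_bool:
  "continuous_map (beta_topology S) (discrete_topology (UNIV :: bool set)) (\<lambda>u. eventually P u)"
proof -
  have "openin (beta_topology S) {u \<in> beta S. eventually P u \<in> W}" for W
  proof -
    have "{u \<in> beta S. eventually P u \<in> W} =
      (if True \<in> W then {u \<in> beta S. eventually P u} else {}) \<union>
      (if False \<in> W then {u \<in> beta S. eventually (\<lambda>x. \<not> P x) u} else {})"
      by (auto simp: beta_eventually_not) (metis (full_types))+
    then show ?thesis
      by (auto intro: openin_beta_topology_basic)
  qed
  then show ?thesis
    by (simp add: continuous_map_def)
qed

lemma rc_maps_unique:
  assumes G: "G \<in> rc_maps Z n K" and H: "H \<in> rc_maps Z n K" and K: "Hausdorff_space K"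
    and eq: "\<And>as. as \<in> tuples Z n \<Longrightarrow> G (map princ as) = H (map princ as)"
  shows "G = H"
proof -
  \<comment> \<open>Descending induction on the number \<open>i\<close> of arguments on the left
    known to be principal. At \<open>i = n\<close> this is the hypothesis; passing from
    \<open>Suc i\<close> to \<open>i\<close> frees the last principal argument, where right
    continuity and density apply.\<close>
  have *: "G (map princ as @ vs) = H (map princ as @ vs)"
    if "as \<in> tuples Z i" "vs \<in> tuples (beta Z) (n - i)" "i \<le> n" for i as vs
    using that(3,1,2)
  proof (induction i arbitrary: as vs rule: inc_induct)
    case base
    then show ?case using eq by (simp add: tuples_def)
  next
    case (step i)
    from step.hyps step.prems(2) obtain u vs'
      where vs: "vs = u # vs'" "u \<in> beta Z" "vs' \<in> tuples (beta Z) (n - Suc i)"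
      by (cases vs) (auto simp: tuples_def)
    have c: "continuous_map (beta_topology Z) K (\<lambda>u. J (map princ as @ u # vs'))"
      if "J \<in> rc_maps Z n K" for J
      using that step.hyps step.prems(1) vs(3) unfolding rc_maps_def by blast
    have "G (map princ as @ u # vs') = H (map princ as @ u # vs')"
    proof (rule continuous_beta_unique[OF c[OF G] c[OF H] K _ vs(2)])
      fix x assume "x \<in> Z"
      then have "as @ [x] \<in> tuples Z (Suc i)"
        using step.prems(1) by (auto simp: tuples_def)
      from step.IH[OF this vs(3)]
      show "G (map princ as @ princ x # vs') = H (map princ as @ princ x # vs')"
        by simp
    qed
    then show ?case by (simp add: vs)
  qed
  show ?thesis
  proof (rule PiE_ext)
    show "G \<in> tuples (beta Z) n \<rightarrow>\<^sub>E topspace K" "H \<in> tuples (beta Z) n \<rightarrow>\<^sub>E topspace K"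
      using G H by (auto simp: rc_maps_def)
    show "G us = H us" if "us \<in> tuples (beta Z) n" for us
      using *[of "[]" 0 us] that by (simp add: tuples_def)
  qed
qed

section \<open>Iterated ultrafilter quantifiers\<close>

lemma uf_all_mono:
  assumes "uf_all us P" "\<And>zs. P zs \<Longrightarrow> Q zs"
  shows "uf_all us Q"
  using is_filter.mono[OF is_filter_uf_all[of us "\<lambda>zs. zs"], of P Q] assms by blast

lemma uf_all_conj: "uf_all us P \<Longrightarrow> uf_all us Q \<Longrightarrow> uf_all us (\<lambda>zs. P zs \<and> Q zs)"
  using is_filter.conj[OF is_filter_uf_all[of us "\<lambda>zs. zs"], of P Q] by blast

lemma uf_all_tuples:
  "us \<in> tuples (beta Z) n \<Longrightarrow> uf_all us (\<lambda>zs. zs \<in> tuples Z n)"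
proof (induction us arbitrary: n)
  case Nil
  then show ?case by (simp add: tuples_def)
next
  case (Cons u us)
  then obtain m where n: "n = Suc m" and u: "u \<in> beta Z" and us: "us \<in> tuples (beta Z) m"
    by (auto simp: tuples_def)
  show ?case
    using beta_eventually[OF u] unfolding uf_all.simps
    by (rule eventually_mono)
      (rule uf_all_mono[OF Cons.IH[OF us]], simp add: n tuples_def)
qed

lemma uf_all_mono_on:
  assumes "us \<in> tuples (beta Z) n" "uf_all us P"
    and "\<And>zs. zs \<in> tuples Z n \<Longrightarrow> P zs \<Longrightarrow> Q zs"
  shows "uf_all us Q"
  using uf_all_conj[OF uf_all_tuples[OF assms(1)] assms(2)] by (rule uf_all_mono) (use assms(3) in blast)

lemma uf_all_princ_append: "uf_all (map princ as @ us) P \<longleftrightarrow> uf_all us (\<lambda>zs. P (as @ zs))"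
  by (induction as arbitrary: P) (simp_all add: eventually_principal)

lemma uf_all_princ: "uf_all (map princ as) P \<longleftrightarrow> P as"
  using uf_all_princ_append[of as "[]" P] by simp

lemma uf_all_filtermap: "uf_all (map (filtermap h) us) P \<longleftrightarrow> uf_all us (\<lambda>zs. P (map h zs))"
  by (induction us arbitrary: P) (simp_all add: eventually_filtermap)

section \<open>Conservativity of the extensions at principal tuples\<close>

lemma princ_in_tilde_rel:
  "as \<in> tuples Z n \<Longrightarrow> map princ as \<in> tilde_rel Z n Q \<longleftrightarrow> as \<in> Q"
  by (simp add: tilde_rel_def uf_all_princ map_princ_in_tuples)

lemma tilde_rel_inj:
  assumes "Q \<subseteq> tuples Z n" "Q' \<subseteq> tuples Z n" "tilde_rel Z n Q = tilde_rel Z n Q'"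
  shows "Q = Q'"
  using assms princ_in_tilde_rel[of _ Z n] by blast

lemma tilde_fun_princ:
  assumes "as \<in> tuples Z n"
  shows "tilde_fun Z n f (map princ as) = princ (f as)"
  by (simp add: filter_eq_iff eventually_tilde_fun map_princ_in_tuples[OF assms] uf_all_princ
      eventually_principal)

lemma princ_in_star_rel:
  assumes "as \<in> tuples Z n"
  shows "map princ as \<in> star_rel Z n Q \<longleftrightarrow> as \<in> Q"
proof -
  \<comment> \<open>For the forward direction the singletons are the sharpest test sets, and their
    product contains only \<open>as\<close>.\<close>
  have singleton: "listset (map (\<lambda>a. {a}) as) = {as}" for as :: "'a list"
    by (induction as) (auto simp: set_Cons_def)
  \<comment> \<open>A family of sets is admissible for the principal tuple exactly when its product
    contains \<open>as\<close>, so \<open>as\<close> itself is the witness for the backward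
    direction.\<close>
  have mem: "as \<in> listset As \<longleftrightarrow> list_all2 (\<lambda>A u. \<forall>\<^sub>F z in u. z \<in> A) As (map princ as)" for As
    by (induction As arbitrary: as)
      (auto simp: set_Cons_def eventually_principal list_all2_Cons1)
  show ?thesis
  proof
    assume "map princ as \<in> star_rel Z n Q"
    moreover have "list_all2 (\<lambda>A u. \<forall>\<^sub>F z in u. z \<in> A) (map (\<lambda>a. {a}) as) (map princ as)"
      unfolding mem[symmetric] by (simp add: singleton)
    ultimately have "Q \<inter> listset (map (\<lambda>a. {a}) as) \<noteq> {}"
      by (simp add: star_rel_def)
    then show "as \<in> Q" by (simp add: singleton)
  next
    assume "as \<in> Q"
    then show "map princ as \<in> star_rel Z n Q"
      using map_princ_in_tuples[OF assms] unfolding star_rel_def by (auto simp flip: mem)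
  qed
qed

section \<open>The operations \<open>e\<close> and \<open>E\<close> on relations\<close>

text \<open>The pointwise limit of relations along \<open>r\<close>, that is, the limit of their
  characteristic functions in the product space of truth values over
  \<open>tuples Z n\<close>.\<close>

definition limit_rel :: "'a set \<Rightarrow> nat \<Rightarrow> 'a list set filter \<Rightarrow> 'a list set" where
  "limit_rel Z n r = {as \<in> tuples Z n. \<forall>\<^sub>F Q in r. as \<in> Q}"

lemma limit_rel_subset: "limit_rel Z n r \<subseteq> tuples Z n"
  by (auto simp: limit_rel_def)

text \<open>A principal prefix merely substitutes its points. The quantifier over \<open>u\<close>
  then comes outermost, so membership depends on \<open>u\<close> as \<open>eventually P u\<close>
  for a fixed \<open>P\<close>.\<close>

lemma tilde_rel_rc:
  "(\<lambda>us\<in>tuples (beta Z) n. us \<in> tilde_rel Z n Q) \<in> rc_maps Z n (discrete_topology (UNIV :: bool set))"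
    (is "?G \<in> _")
proof -
  have "continuous_map (beta_topology Z) (discrete_topology UNIV) (\<lambda>u. ?G (map princ as @ u # vs))"
    if "i < n" "as \<in> tuples Z i" "vs \<in> tuples (beta Z) (n - Suc i)" for i as vs
  proof (rule continuous_map_eq[OF continuous_map_beta_bool])
    fix u assume "u \<in> topspace (beta_topology Z)"
    then have "map princ as @ u # vs \<in> tuples (beta Z) n"
      using that map_princ_in_tuples[OF that(2)] by (auto simp: tuples_def)
    then show "(\<forall>\<^sub>F z in u. uf_all vs (\<lambda>zs. as @ z # zs \<in> Q)) = ?G (map princ as @ u # vs)"
      by (simp add: tilde_rel_def uf_all_princ_append)
  qed
  then show ?thesis
    by (auto simp: rc_maps_def)
qed

text \<open>Evaluation at a principal tuple is a coordinate projection after the restriction map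
  along which the topology is pulled back.\<close>

lemma continuous_map_rc_eval:
  assumes "continuous_map X (rc_topology Z n K) g" "as \<in> tuples Z n"
  shows "continuous_map X K (\<lambda>x. g x (map princ as))"
proof -
  have "continuous_map (rc_topology Z n K) K ((\<lambda>G. G as) \<circ> (\<lambda>G. \<lambda>as\<in>tuples Z n. G (map princ as)))"
    unfolding rc_topology_def
    by (intro continuous_map_pullback continuous_map_product_projection assms(2))
  from continuous_map_compose[OF assms(1) this] show ?thesis
    using assms(2) by (simp add: o_def)
qed

lemma topspace_rc_topology: "topspace (rc_topology Z n K) \<subseteq> rc_maps Z n K"
  by (auto simp: rc_topology_def topspace_pullback_topology)

text \<open>The map sending \<open>r\<close> to the extension of its pointwise limit is shown to be
  the unique object described in \<open>beta_ext\<close>.\<close>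

lemma e_rel_eq:
  assumes r: "r \<in> beta (Pow (tuples Z n))"
  shows "e_rel Z n r = tilde_rel Z n (limit_rel Z n r)"
proof -
  let ?D = "discrete_topology (UNIV :: bool set)"
  let ?T = "rc_topology Z n ?D"
  let ?S = "Pow (tuples Z n)"
  let ?\<phi> = "\<lambda>Q. \<lambda>us\<in>tuples (beta Z) n. us \<in> tilde_rel Z n Q"
  define g where "g = (\<lambda>r\<in>beta ?S. ?\<phi> (limit_rel Z n r))"
  have at_princ: "g r (map princ as) \<longleftrightarrow> (\<forall>\<^sub>F Q in r. as \<in> Q)"
    if "r \<in> beta ?S" "as \<in> tuples Z n" for r as
    using that by (simp add: g_def map_princ_in_tuples princ_in_tilde_rel limit_rel_def)
  \<comment> \<open>In the pullback topology only coordinates at principal tuples matter, and there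
    \<open>g\<close> is the continuous map
    \<open>eventually (\<lambda>Q. as \<in> Q)\<close>.\<close>
  have cont: "continuous_map (beta_topology ?S) ?T g"
    unfolding rc_topology_def
  proof (rule continuous_map_pullback')
    show "continuous_map (beta_topology ?S) (product_topology (\<lambda>_. ?D) (tuples Z n))
        ((\<lambda>G. \<lambda>as\<in>tuples Z n. G (map princ as)) \<circ> g)"
      unfolding continuous_map_componentwise
    proof (intro conjI ballI)
      fix as assume "as \<in> tuples Z n"
      then show "continuous_map (beta_topology ?S) ?D
          (\<lambda>r. ((\<lambda>G. \<lambda>as\<in>tuples Z n. G (map princ as)) \<circ> g) r as)"
        by (intro continuous_map_eq[OF continuous_map_beta_bool[of ?S "\<lambda>Q. as \<in> Q"]])
          (simp add: at_princ)
    qed auto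
    show "topspace (beta_topology ?S) \<subseteq> g -` rc_maps Z n ?D"
      using tilde_rel_rc by (auto simp: g_def)
  qed
  have g_princ: "g (princ Q) = ?\<phi> Q" if "Q \<in> ?S" for Q
  proof -
    have "limit_rel Z n (princ Q) = Q"
      using that by (auto simp: limit_rel_def eventually_principal)
    then show ?thesis
      using princ_in_beta[OF that] by (simp add: g_def)
  qed
  have "beta_ext ?S ?T ?\<phi> = g"
    unfolding beta_ext_def
  proof (rule the_equality)
    show "g \<in> extensional (beta ?S) \<and> continuous_map (beta_topology ?S) ?T g \<and>
        (\<forall>x\<in>?S. g (princ x) = ?\<phi> x)"
      using cont g_princ by (simp add: g_def)
  next
    fix g'
    assume g': "g' \<in> extensional (beta ?S) \<and> continuous_map (beta_topology ?S) ?T g' \<and>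
        (\<forall>x\<in>?S. g' (princ x) = ?\<phi> x)"
    show "g' = g"
    proof (rule extensionalityI[of _ "beta ?S"])
      show "g' \<in> extensional (beta ?S)" "g \<in> extensional (beta ?S)"
        using g' by (simp_all add: g_def)
      fix r assume r: "r \<in> beta ?S"
      show "g' r = g r"
      \<comment> \<open>Density is used twice: first to reduce to principal arguments
        \<open>map princ as\<close>, then, with \<open>as\<close> fixed, to reduce \<open>r\<close>
        to a principal ultrafilter.\<close>
      proof (rule rc_maps_unique)
        show "g' r \<in> rc_maps Z n ?D" "g r \<in> rc_maps Z n ?D"
          using g' cont r topspace_rc_topology[of Z n ?D]
          by (auto dest!: continuous_map_funspace)
        show "Hausdorff_space ?D" by simp
        fix as assume as: "as \<in> tuples Z n"
        show "g' r (map princ as) = g r (map princ as)"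
        proof (rule continuous_beta_unique[OF _ _ _ _ r])
          show "continuous_map (beta_topology ?S) ?D (\<lambda>r. g' r (map princ as))"
            "continuous_map (beta_topology ?S) ?D (\<lambda>r. g r (map princ as))"
            using g' cont by (blast intro: continuous_map_rc_eval[OF _ as])+
          show "g' (princ Q) (map princ as) = g (princ Q) (map princ as)" if "Q \<in> ?S" for Q
            using g' g_princ[OF that] that by metis
        qed simp
      qed
    qed
  qed
  then have "e_rel Z n r = {us \<in> tuples (beta Z) n. g r us}"
    by (simp only: e_rel_def)
  also have "\<dots> = tilde_rel Z n (limit_rel Z n r)"
  proof (rule set_eqI)
    fix us
    show "us \<in> {us \<in> tuples (beta Z) n. g r us} \<longleftrightarrow> us \<in> tilde_rel Z n (limit_rel Z n r)"
      by (cases "us \<in> tuples (beta Z) n") (simp_all add: g_def r tilde_rel_def)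
  qed
  finally show ?thesis .
qed

text \<open>This is \<open>e_rel_eq\<close> for unary relations over the base set
  \<open>tuples Z n\<close>: an ultrafilter lies in the extension of a unary relation iff it
  contains that relation. The renaming of \<open>x\<close> to \<open>[x]\<close> commutes with the
  limit.\<close>

lemma e1_rel_eq:
  assumes r: "r \<in> beta (Pow (tuples Z n))"
  shows "e1_rel Z n r = {q \<in> beta (tuples Z n). \<forall>\<^sub>F x in q. x \<in> limit_rel Z n r}"
proof -
  let ?r = "filtermap (\<lambda>Q. (\<lambda>x. [x]) ` Q) r"
  have "?r \<in> beta (Pow (tuples (tuples Z n) 1))"
    by (rule filtermap_in_beta[OF _ r]) (auto simp: tuples_def)
  then have "e_rel (tuples Z n) 1 ?r = tilde_rel (tuples Z n) 1 (limit_rel (tuples Z n) 1 ?r)"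
    by (rule e_rel_eq)
  moreover have "[x] \<in> limit_rel (tuples Z n) 1 ?r \<longleftrightarrow> x \<in> limit_rel Z n r" for x
    by (auto simp: limit_rel_def eventually_filtermap tuples_def image_iff)
  ultimately show ?thesis
    by (auto simp: e1_rel_def tilde_rel_def tuples_def)
qed

section \<open>Star extensions as projections of ultrafilters on tuples\<close>

lemma listset_iff: "zs \<in> listset As \<longleftrightarrow> list_all2 (\<in>) zs As"
  by (induction As arbitrary: zs) (auto simp: set_Cons_def list_all2_Cons2)

text \<open>The star extension is the image under the coordinate projections of the closure of
  \<open>Q\<close> in the space of ultrafilters on \<open>tuples Z n\<close>.\<close>

lemma star_rel_iff_projections:
  assumes Q: "Q \<subseteq> tuples Z n"
  shows "us \<in> star_rel Z n Q \<longleftrightarrow>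
    (\<exists>q\<in>beta (tuples Z n). (\<forall>\<^sub>F x in q. x \<in> Q) \<and> us = map (\<lambda>i. filtermap (\<lambda>xs. xs ! i) q) [0..<n])"
proof
  assume us: "us \<in> star_rel Z n Q"
  then have len: "length us = n" and ub: "\<And>i. i < n \<Longrightarrow> us ! i \<in> beta Z"
    by (auto simp: star_rel_def tuples_def)
  \<comment> \<open>\<open>F\<close> is generated by \<open>Q\<close> and the cylinders over members
    of the given ultrafilters; an ultrafilter below it is the required \<open>q\<close>. Its
    properness is what membership in \<open>star_rel\<close> provides.\<close>
  define F where "F = inf (INF i\<in>{..<n}. filtercomap (\<lambda>xs. xs ! i) (us ! i)) (principal Q)"
  have "F \<noteq> bot"
  proof
    assume "F = bot"
    then have "eventually (\<lambda>xs. xs \<notin> Q) (INF i\<in>{..<n}. filtercomap (\<lambda>xs. xs ! i) (us ! i))"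
      unfolding F_def trivial_limit_def eventually_inf_principal by simp
    then obtain P where P: "\<And>i. i < n \<Longrightarrow> eventually (P i) (filtercomap (\<lambda>xs. xs ! i) (us ! i))"
      and notQ: "\<And>xs. (\<And>i. i < n \<Longrightarrow> P i xs) \<Longrightarrow> xs \<notin> Q"
      unfolding eventually_INF_finite[OF finite_lessThan] lessThan_iff Ball_def by metis
    \<comment> \<open>Each \<open>P i\<close> holds on a cylinder over some set in
      \<open>us ! i\<close>. The product of these sets would miss \<open>Q\<close>, contradicting
      the star condition.\<close>
    have "\<forall>i. \<exists>A. i < n \<longrightarrow> (\<forall>\<^sub>F z in us ! i. z \<in> A) \<and> (\<forall>xs. xs ! i \<in> A \<longrightarrow> P i xs)"
    proof (intro allI)
      fix i
      show "\<exists>A. i < n \<longrightarrow> (\<forall>\<^sub>F z in us ! i. z \<in> A) \<and> (\<forall>xs. xs ! i \<in> A \<longrightarrow> P i xs)"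
      proof (cases "i < n")
        case True
        then obtain R where "eventually R (us ! i)" "\<forall>xs. R (xs ! i) \<longrightarrow> P i xs"
          using P unfolding eventually_filtercomap by blast
        then show ?thesis by (intro exI[of _ "Collect R"]) simp
      qed simp
    qed
    then obtain A where A: "\<And>i. i < n \<Longrightarrow> \<forall>\<^sub>F z in us ! i. z \<in> A i"
      "\<And>i xs. i < n \<Longrightarrow> xs ! i \<in> A i \<Longrightarrow> P i xs"
      by metis
    have "list_all2 (\<lambda>A u. \<forall>\<^sub>F z in u. z \<in> A) (map A [0..<n]) us"
      using A(1) len by (simp add: list_all2_conv_all_nth)
    then obtain zs where zs: "zs \<in> Q" "zs \<in> listset (map A [0..<n])"
      using us unfolding star_rel_def by blast
    then have "zs ! i \<in> A i" if "i < n" for i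
      using that by (auto simp: listset_iff list_all2_conv_all_nth)
    then show False
      using notQ[of zs] A(2) zs(1) by blast
  qed
  then obtain q where q: "q \<in> beta UNIV" "q \<le> F"
    using exists_ultrafilter_le by blast
  have qQ: "\<forall>\<^sub>F x in q. x \<in> Q"
    using q(2) by (rule filter_leD) (simp add: F_def eventually_inf_principal)
  have "q \<in> beta (tuples Z n)"
  proof -
    have "\<forall>\<^sub>F x in q. x \<in> tuples Z n"
      using qQ by (rule eventually_mono) (use Q in blast)
    then show ?thesis
      using q(1) by (simp add: beta_def)
  qed
  moreover have "us = map (\<lambda>i. filtermap (\<lambda>xs. xs ! i) q) [0..<n]"
  proof (rule nth_equalityI)
    fix i assume "i < length us"
    then have i: "i < n" by (simp add: len)
    \<comment> \<open>The projection of \<open>q\<close> is a proper filter below the ultrafilter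
      \<open>us ! i\<close>, hence equal to it by minimality.\<close>
    have "q \<le> filtercomap (\<lambda>xs. xs ! i) (us ! i)"
      using q(2) i unfolding F_def by (meson INF_lower inf.cobounded1 lessThan_iff order_trans)
    then have "filtermap (\<lambda>xs. xs ! i) q \<le> us ! i"
      by (simp add: filtermap_le_iff_le_filtercomap)
    then have "filtermap (\<lambda>xs. xs ! i) q = us ! i"
      using beta_not_bot[OF q(1)] by (intro beta_le_imp_eq[OF ub[OF i]]) (simp add: filtermap_bot_iff)
    then show "us ! i = map (\<lambda>i. filtermap (\<lambda>xs. xs ! i) q) [0..<n] ! i"
      using i by simp
  qed (simp add: len)
  ultimately show "\<exists>q\<in>beta (tuples Z n). (\<forall>\<^sub>F x in q. x \<in> Q) \<and>
      us = map (\<lambda>i. filtermap (\<lambda>xs. xs ! i) q) [0..<n]"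
    using qQ by blast
next
  assume "\<exists>q\<in>beta (tuples Z n). (\<forall>\<^sub>F x in q. x \<in> Q) \<and>
      us = map (\<lambda>i. filtermap (\<lambda>xs. xs ! i) q) [0..<n]"
  then obtain q where q: "q \<in> beta (tuples Z n)" "\<forall>\<^sub>F x in q. x \<in> Q"
    and us: "us = map (\<lambda>i. filtermap (\<lambda>xs. xs ! i) q) [0..<n]"
    by blast
  have "filtermap (\<lambda>xs. xs ! i) q \<in> beta Z" if "i < n" for i
    using that by (intro filtermap_in_beta[OF _ q(1)]) (auto simp: tuples_def)
  then have "us \<in> tuples (beta Z) n"
    by (auto simp: tuples_def us)
  moreover have "Q \<inter> listset As \<noteq> {}" if "list_all2 (\<lambda>A u. \<forall>\<^sub>F z in u. z \<in> A) As us" for As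
  proof -
    have len: "length As = n" and ev: "\<And>i. i < n \<Longrightarrow> \<forall>\<^sub>F xs in q. xs ! i \<in> As ! i"
      using that by (auto simp: list_all2_conv_all_nth us eventually_filtermap)
    \<comment> \<open>The finitely many cylinders and \<open>Q\<close> all belong to
      \<open>q\<close>, so they have a common point.\<close>
    have "\<forall>\<^sub>F xs in q. \<forall>i\<in>{..<n}. xs ! i \<in> As ! i"
      using ev by (intro eventually_ball_finite) auto
    with q(2) have "\<forall>\<^sub>F xs in q. xs \<in> Q \<and> (\<forall>i\<in>{..<n}. xs ! i \<in> As ! i)"
      by (rule eventually_conj)
    then obtain xs where xs: "xs \<in> Q" "\<forall>i\<in>{..<n}. xs ! i \<in> As ! i"
      using eventually_happens'[OF beta_not_bot[OF q(1)]] by blast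
    then have "xs \<in> listset As"
      using Q len by (auto simp: listset_iff list_all2_conv_all_nth tuples_def)
    then show ?thesis using xs(1) by blast
  qed
  ultimately show "us \<in> star_rel Z n Q"
    by (simp add: star_rel_def)
qed

lemma E_rel_eq:
  assumes "r \<in> beta (Pow (tuples Z n))"
  shows "E_rel Z n r = star_rel Z n (limit_rel Z n r)"
proof (rule set_eqI)
  fix us
  show "us \<in> E_rel Z n r \<longleftrightarrow> us \<in> star_rel Z n (limit_rel Z n r)"
    by (simp add: star_rel_iff_projections[OF limit_rel_subset] E_rel_def e1_rel_eq[OF assms]
        Bex_def conj_ac)
qed

text \<open>Comparing the two tilde extensions at principal tuples identifies each relation of
  \<open>A\<close> with the limit of its interpreting ultrafilter, so the star extensions agree as
  well. The functional parts are those of the assumed equation.\<close>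

lemma star_model_eq_E_model:
  assumes U: "is_gmodel \<sigma> U" and A: "is_model \<sigma> A" and base: "universe A = gbase U"
    and eq: "tilde_model \<sigma> A = e_model \<sigma> U"
  shows "star_model \<sigma> A = E_model \<sigma> U"
proof -
  have "star_rel (gbase U) (rel_ar \<sigma> R) (rel_int A R) = E_rel (gbase U) (rel_ar \<sigma> R) (grel_int U R)"
    if R: "R \<in> rel_syms \<sigma>" for R
  proof -
    let ?Z = "gbase U" and ?n = "rel_ar \<sigma> R" and ?r = "grel_int U R"
    have r: "?r \<in> beta (Pow (tuples ?Z ?n))"
      using U R by (simp add: is_gmodel_def)
    have Q: "rel_int A R \<subseteq> tuples ?Z ?n"
      using A R by (auto simp: is_model_def base)
    have "rel_int (tilde_model \<sigma> A) R = rel_int (e_model \<sigma> U) R"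
      by (simp add: eq)
    then have "tilde_rel ?Z ?n (rel_int A R) = tilde_rel ?Z ?n (limit_rel ?Z ?n ?r)"
      using R by (simp add: tilde_model_def e_model_def base e_rel_eq[OF r])
    then have "rel_int A R = limit_rel ?Z ?n ?r"
      by (rule tilde_rel_inj[OF Q limit_rel_subset])
    then show ?thesis
      by (simp add: E_rel_eq[OF r])
  qed
  then have "rel_int (star_model \<sigma> A) = rel_int (E_model \<sigma> U)"
    by (simp add: star_model_def E_model_def base cong: restrict_cong)
  then show ?thesis
    using eq by (simp add: star_model_def tilde_model_def e_model_def E_model_def)
qed

section \<open>Homomorphisms\<close>

lemma tilde_fun_hom:
  assumes "h \<in> X \<rightarrow> Y" and us: "us \<in> tuples (beta X) n"
    and hom: "\<And>xs. xs \<in> tuples X n \<Longrightarrow> h (f xs) = f' (map h xs)"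
  shows "filtermap h (tilde_fun X n f us) = tilde_fun Y n f' (map (filtermap h) us)"
proof -
  note us' = map_filtermap_in_tuples[OF assms(1) us]
  \<comment> \<open>The homomorphism equation is known only on \<open>tuples X n\<close>, which the
    iterated quantifier over \<open>us\<close> already guarantees.\<close>
  have "uf_all us (\<lambda>zs. P (h (f zs))) \<longleftrightarrow> uf_all us (\<lambda>zs. P (f' (map h zs)))" for P
    using hom by (auto elim!: uf_all_mono_on[OF us])
  then show ?thesis
    by (simp add: filter_eq_iff eventually_filtermap eventually_tilde_fun[OF us]
        eventually_tilde_fun[OF us'] uf_all_filtermap)
qed

lemma tilde_rel_hom:
  assumes "h \<in> X \<rightarrow> Y" and us: "us \<in> tilde_rel X n Q"
    and hom: "\<And>xs. xs \<in> Q \<Longrightarrow> map h xs \<in> Q'"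
  shows "map (filtermap h) us \<in> tilde_rel Y n Q'"
proof -
  have "map (filtermap h) us \<in> tuples (beta Y) n"
    using map_filtermap_in_tuples[OF assms(1)] us by (simp add: tilde_rel_def)
  then show ?thesis
    using us hom by (auto simp: tilde_rel_def uf_all_filtermap elim: uf_all_mono)
qed

lemma star_rel_hom:
  assumes "h \<in> X \<rightarrow> Y" and us: "us \<in> star_rel X n Q"
    and hom: "\<And>xs. xs \<in> Q \<Longrightarrow> map h xs \<in> Q'"
  shows "map (filtermap h) us \<in> star_rel Y n Q'"
proof -
  have "map (filtermap h) us \<in> tuples (beta Y) n"
    using map_filtermap_in_tuples[OF assms(1)] us by (simp add: star_rel_def)
  moreover have "Q' \<inter> listset As \<noteq> {}"
    if "list_all2 (\<lambda>A u. \<forall>\<^sub>F z in u. z \<in> A) As (map (filtermap h) us)" for As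
  proof -
    \<comment> \<open>Test sets in \<open>Y\<close> are pulled back along \<open>h\<close>; the
      image of a tuple of \<open>Q\<close> in the pulled back product is the required tuple of
      \<open>Q'\<close>.\<close>
    have "list_all2 (\<lambda>A u. \<forall>\<^sub>F z in u. z \<in> A) (map (\<lambda>A. h -` A) As) us"
      using that by (simp add: list_all2_map1 list_all2_map2 eventually_filtermap)
    then obtain zs where "zs \<in> Q" "zs \<in> listset (map (\<lambda>A. h -` A) As)"
      using us unfolding star_rel_def by blast
    then have "map h zs \<in> Q'" "map h zs \<in> listset As"
      using hom by (auto simp: listset_iff list_all2_map1 list_all2_map2)
    then show ?thesis by blast
  qed
  ultimately show ?thesis
    by (simp add: star_rel_def)
qed

text \<open>Isolates what the tilde and star extensions of relations share, conservativity at
  principal tuples (\<open>extA\<close>, \<open>extB\<close>) and preservation under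
  \<open>filtermap h\<close> (\<open>ext_hom\<close>), so that both equivalences become
  instances.\<close>

lemma homomorphism_extension_iff:
  fixes A :: "('a, 'f, 'r) model" and B :: "('b, 'f, 'r) model"
  assumes A: "is_model \<sigma> A" and B: "is_model \<sigma> B"
    and h: "h \<in> universe A \<rightarrow> universe B"
    and M: "universe M = beta (universe A)" "\<And>F. F \<in> fun_syms \<sigma> \<Longrightarrow>
        fun_int M F = tilde_fun (universe A) (fun_ar \<sigma> F) (fun_int A F)"
      "\<And>R. R \<in> rel_syms \<sigma> \<Longrightarrow> rel_int M R = extA (rel_ar \<sigma> R) (rel_int A R)"
    and N: "universe N = beta (universe B)" "\<And>F. F \<in> fun_syms \<sigma> \<Longrightarrow>
        fun_int N F = tilde_fun (universe B) (fun_ar \<sigma> F) (fun_int B F)"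
      "\<And>R. R \<in> rel_syms \<sigma> \<Longrightarrow> rel_int N R = extB (rel_ar \<sigma> R) (rel_int B R)"
    and extA: "\<And>n as Q. as \<in> tuples (universe A) n \<Longrightarrow> map princ as \<in> extA n Q \<longleftrightarrow> as \<in> Q"
    and extB: "\<And>n bs Q. bs \<in> tuples (universe B) n \<Longrightarrow> map princ bs \<in> extB n Q \<longleftrightarrow> bs \<in> Q"
    and ext_hom: "\<And>n us Q Q'. us \<in> extA n Q \<Longrightarrow> (\<And>xs. xs \<in> Q \<Longrightarrow> map h xs \<in> Q') \<Longrightarrow>
      map (filtermap h) us \<in> extB n Q'"
  shows "homomorphism \<sigma> A B h \<longleftrightarrow> homomorphism \<sigma> M N (filtermap h)"
proof
  assume hom: "homomorphism \<sigma> A B h"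
  have "filtermap h \<in> beta (universe A) \<rightarrow> beta (universe B)"
    using h by (auto intro: filtermap_in_beta)
  then show "homomorphism \<sigma> M N (filtermap h)"
    using hom unfolding homomorphism_def
    by (auto simp: M N intro!: tilde_fun_hom[OF h] intro: ext_hom)
next
  assume hom: "homomorphism \<sigma> M N (filtermap h)"
  have "h (fun_int A F xs) = fun_int B F (map h xs)"
    if F: "F \<in> fun_syms \<sigma>" and xs: "xs \<in> tuples (universe A) (fun_ar \<sigma> F)" for F xs
  proof -
    \<comment> \<open>At principal tuples all operations take principal values, and
      \<open>princ\<close> is injective, so the equation descends to the points.\<close>
    have "filtermap h (fun_int M F (map princ xs)) = fun_int N F (map (filtermap h) (map princ xs))"
      using hom F map_princ_in_tuples[OF xs] unfolding homomorphism_def by (simp add: M)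
    then have "princ (h (fun_int A F xs)) = princ (fun_int B F (map h xs))"
      unfolding filtermap_map_princ M(2)[OF F] N(2)[OF F] tilde_fun_princ[OF xs]
        tilde_fun_princ[OF map_in_tuples[OF h xs]] by simp
    then show ?thesis by simp
  qed
  moreover have "map h xs \<in> rel_int B R" if R: "R \<in> rel_syms \<sigma>" and xs: "xs \<in> rel_int A R" for R xs
  proof -
    have tup: "xs \<in> tuples (universe A) (rel_ar \<sigma> R)"
      using A R xs by (auto simp: is_model_def)
    then have "map princ xs \<in> rel_int M R"
      using xs by (simp add: M(3)[OF R] extA)
    then have "map (filtermap h) (map princ xs) \<in> rel_int N R"
      using hom R unfolding homomorphism_def by blast
    then show ?thesis
      unfolding filtermap_map_princ N(3)[OF R] extB[OF map_in_tuples[OF h tup]] .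
  qed
  ultimately show "homomorphism \<sigma> A B h"
    using h by (simp add: homomorphism_def)
qed

theorem theorem32:
  fixes \<sigma> :: "('f, 'r) signature"
    and U :: "('a, 'f, 'r) gmodel" and V :: "('b, 'f, 'r) gmodel"
    and A :: "('a, 'f, 'r) model" and B :: "('b, 'f, 'r) model"
    and h :: "'a \<Rightarrow> 'b"
  assumes "is_gmodel \<sigma> U" and "is_gmodel \<sigma> V"
    and "pseudo_principal_on_funs \<sigma> U" and "pseudo_principal_on_funs \<sigma> V"
    and "is_model \<sigma> A" and "is_model \<sigma> B"
    and "universe A = gbase U" and "universe B = gbase V"
    and "tilde_model \<sigma> A = e_model \<sigma> U" and "tilde_model \<sigma> B = e_model \<sigma> V"
    and "h \<in> universe A \<rightarrow> universe B"
  shows "(star_model \<sigma> A = E_model \<sigma> U \<and> star_model \<sigma> B = E_model \<sigma> V) \<and>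
    (homomorphism \<sigma> A B h \<longleftrightarrow> gen_homomorphism \<sigma> U V (filtermap h)) \<and>
    (homomorphism \<sigma> A B h \<longleftrightarrow>
       homomorphism \<sigma> (tilde_model \<sigma> A) (tilde_model \<sigma> B) (filtermap h)) \<and>
    (homomorphism \<sigma> A B h \<longleftrightarrow>
       homomorphism \<sigma> (star_model \<sigma> A) (star_model \<sigma> B) (filtermap h))"
proof -
  note h = assms(11)
  have tilde: "homomorphism \<sigma> A B h \<longleftrightarrow>
      homomorphism \<sigma> (tilde_model \<sigma> A) (tilde_model \<sigma> B) (filtermap h)"
    by (rule homomorphism_extension_iff[OF assms(5,6) h,
          where extA = "tilde_rel (universe A)" and extB = "tilde_rel (universe B)"])
      (auto simp: tilde_model_def princ_in_tilde_rel intro: tilde_rel_hom[OF h])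
  have star: "homomorphism \<sigma> A B h \<longleftrightarrow>
      homomorphism \<sigma> (star_model \<sigma> A) (star_model \<sigma> B) (filtermap h)"
    by (rule homomorphism_extension_iff[OF assms(5,6) h,
          where extA = "star_rel (universe A)" and extB = "star_rel (universe B)"])
      (auto simp: star_model_def princ_in_star_rel intro: star_rel_hom[OF h])
  have "star_model \<sigma> A = E_model \<sigma> U" "star_model \<sigma> B = E_model \<sigma> V"
    using assms by (blast intro: star_model_eq_E_model)+
  \<comment> \<open>Homomorphisms of generalized models are those of the \<open>e_model\<close>s,
    which are rewritten back to the tilde models.\<close>
  with tilde star show ?thesis
    by (simp add: gen_homomorphism_def flip: assms(9,10))
qed

end
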